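(* Let $\mathcal{C}$ be a $2$-Calabi-Yau triangulated category (with the standing assumptions given in the context). If $\mathcal{C}$ admits a cluster-tilting subcategory $\mathcal{T}$, then every functorially finite maximal rigid subcategory of $\mathcal{C}$ is cluster-tilting.
   Context: Let $k$ be an algebraically closed field. $\mathcal{C}$ is a $k$-linear triangulated category with shift functor $[1]$, which is Hom-finite ($\dim_k \mathrm{Hom}(X,Y)<\infty$ for all $X,Y$) and Krull-Remak-Schmidt (every object is, uniquely up to isomorphism, a finite direct sum of indecomposable objects). Put $\mathrm{Ext}^n(X,Y)=\mathrm{Hom}(X,Y[n])$. $\mathcal{C}$ is called $2$-Calabi-Yau ($2$-CY) if there are bifunctorial isomorphisms $\mathrm{Ext}^1(X,Y)\cong D\,\mathrm{Ext}^1(Y,X)$ for $X,Y\in\mathcal{C}$, where $D=\mathrm{Hom}_k(-,k)$. Subcategories are full and closed under isomorphism. A morphism $f:T\to X$ with $T\in\mathcal{T}$ is a right $\mathcal{T}$-approximation of $X$ if every morphism from an object of $\mathcal{T}$ to $X$ factors through $f$; $\mathcal{T}$ is contravariantly finite if every object of $\mathcal{C}$ has a right $\mathcal{T}$-approximation. Left approximations and covariantly finite subcategories are defined dually; $\mathcal{T}$ is functorially finite if it is both covariantly and contravariantly finite. Let $\mathcal{T}$ be a subcategory closed under direct summands and finite direct sums, and let $\mathrm{add}\,M$ be the subcategory of direct summands of finite direct sums of copies of $M$. $\mathcal{T}$ is rigid if $\mathrm{Ext}^1(T,T')=0$ for all $T,T'\in\mathcal{T}$. $\mathcal{T}$ is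 maximal rigid if it is rigid and, whenever $\mathrm{Ext}^1(\mathcal{T}\cup\mathrm{add}\,M,\mathcal{T}\cup\mathrm{add}\,M)=0$, one has $M\in\mathcal{T}$. $\mathcal{T}$ is cluster-tilting if it is functorially finite and $\mathcal{T}=\{X\in\mathcal{C}\mid \mathrm{Hom}(X,T[1])=0 \text{ for all } T\in\mathcal{T}\}$. *)

theory Defs
  imports "HOL-Algebra.Algebraic_Closure" "Jordan_Normal_Form.Missing_VectorSpace"
begin

no_notation var (\<open>X\<index>\<close>)
hide_const (open) Multiset.mult

section \<open>Linear categories\<close>

text \<open>
  The objects are all elements of the type \<open>'o\<close>, and \<open>Hom C X Y\<close> is a module record, so that it
  carries its own zero, addition and scalar multiplication. Composition \<open>g \<star> f\<close> is in the
  usual order (first \<open>f\<close>, then \<open>g\<close>). Composition and the action of the shift on morphisms are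
  not indexed by objects: as usual a morphism is thought of as knowing its source and target.
  They are only constrained on composable morphisms, resp. on morphisms, and disjointness of the
  Hom-spaces is not required. A triangle \<open>X \<rightarrow> Y \<rightarrow> Z \<rightarrow> X[1]\<close> is stored together with its objects.
\<close>

record ('k, 'o, 'm) shift_category =
  Hom :: "'o \<Rightarrow> 'o \<Rightarrow> ('k, 'm) module"
  ident :: "'o \<Rightarrow> 'm"
  compose :: "'m \<Rightarrow> 'm \<Rightarrow> 'm" (infixl \<open>\<star>\<index>\<close> 70)
  shift :: "'o \<Rightarrow> 'o"
  shift_mor :: "'m \<Rightarrow> 'm"
  triangles :: "('o \<times> 'o \<times> 'o \<times> 'm \<times> 'm \<times> 'm) set"

abbreviation mor :: "('k, 'o, 'm, 'z) shift_category_scheme \<Rightarrow> 'o \<Rightarrow> 'o \<Rightarrow> 'm set" where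
  "mor C X Y \<equiv> carrier (Hom C X Y)"

locale linear_category =
  fixes K :: "('k, 'r) ring_scheme"
    and C :: "('k, 'o, 'm, 'z) shift_category_scheme" (structure)
  assumes Hom_vectorspace: "vectorspace K (Hom C X Y)"
    and ident_mor: "ident C X \<in> mor C X X"
    and compose_mor: "\<lbrakk>f \<in> mor C X Y; g \<in> mor C Y Z\<rbrakk> \<Longrightarrow> g \<star> f \<in> mor C X Z"
    and compose_assoc: "\<lbrakk>f \<in> mor C X Y; g \<in> mor C Y Z; h \<in> mor C Z W\<rbrakk>
      \<Longrightarrow> h \<star> (g \<star> f) = (h \<star> g) \<star> f"
    and ident_left: "f \<in> mor C X Y \<Longrightarrow> ident C Y \<star> f = f"
    and ident_right: "f \<in> mor C X Y \<Longrightarrow> f \<star> ident C X = f"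
    and compose_linear_right: "g \<in> mor C Y Z
      \<Longrightarrow> (\<lambda>f. g \<star> f) \<in> module_hom K (Hom C X Y) (Hom C X Z)"
    and compose_linear_left: "f \<in> mor C X Y
      \<Longrightarrow> (\<lambda>g. g \<star> f) \<in> module_hom K (Hom C Y Z) (Hom C X Z)"

definition iso_mor :: "('k, 'o, 'm, 'z) shift_category_scheme \<Rightarrow> 'o \<Rightarrow> 'o \<Rightarrow> 'm \<Rightarrow> bool" where
  "iso_mor C X Y f \<longleftrightarrow> f \<in> mor C X Y \<and>
     (\<exists>g \<in> mor C Y X. g \<star>\<^bsub>C\<^esub> f = ident C X \<and> f \<star>\<^bsub>C\<^esub> g = ident C Y)"

definition isomorphic :: "('k, 'o, 'm, 'z) shift_category_scheme \<Rightarrow> 'o \<Rightarrow> 'o \<Rightarrow> bool" where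
  "isomorphic C X Y \<longleftrightarrow> (\<exists>f. iso_mor C X Y f)"

definition zero_object :: "('k, 'o, 'm, 'z) shift_category_scheme \<Rightarrow> 'o \<Rightarrow> bool" where
  "zero_object C Z \<longleftrightarrow>
     (\<forall>X. mor C Z X = {\<zero>\<^bsub>Hom C Z X\<^esub>} \<and> mor C X Z = {\<zero>\<^bsub>Hom C X Z\<^esub>})"

text \<open>
  \<open>direct_sum C [Y\<^sub>0, \<dots>, Y\<^sub>n\<^sub>-\<^sub>1] X\<close> says that \<open>X\<close> is a direct sum (biproduct) of the \<open>Y\<^sub>i\<close>. For the
  empty list it says that the identity of \<open>X\<close> vanishes, i.e. that \<open>X\<close> is a zero object.
\<close>

definition direct_sum :: "('k, 'o, 'm, 'z) shift_category_scheme \<Rightarrow> 'o list \<Rightarrow> 'o \<Rightarrow> bool" where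
  "direct_sum C Ys X \<longleftrightarrow> (\<exists>\<iota> \<pi>.
     (\<forall>i < length Ys. \<iota> i \<in> mor C (Ys ! i) X \<and> \<pi> i \<in> mor C X (Ys ! i)) \<and>
     (\<forall>i < length Ys. \<forall>j < length Ys. \<pi> i \<star>\<^bsub>C\<^esub> \<iota> j =
        (if i = j then ident C (Ys ! i) else \<zero>\<^bsub>Hom C (Ys ! j) (Ys ! i)\<^esub>)) \<and>
     (\<Oplus>\<^bsub>Hom C X X\<^esub> i \<in> {..<length Ys}. \<iota> i \<star>\<^bsub>C\<^esub> \<pi> i) = ident C X)"

definition direct_summand :: "('k, 'o, 'm, 'z) shift_category_scheme \<Rightarrow> 'o \<Rightarrow> 'o \<Rightarrow> bool" where
  "direct_summand C A X \<longleftrightarrow> (\<exists>B. direct_sum C [A, B] X)"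

definition indecomposable :: "('k, 'o, 'm, 'z) shift_category_scheme \<Rightarrow> 'o \<Rightarrow> bool" where
  "indecomposable C X \<longleftrightarrow> \<not> zero_object C X \<and>
     (\<forall>A B. direct_sum C [A, B] X \<longrightarrow> zero_object C A \<or> zero_object C B)"

definition hom_finite ::
    "('k, 'r) ring_scheme \<Rightarrow> ('k, 'o, 'm, 'z) shift_category_scheme \<Rightarrow> bool" where
  "hom_finite K C \<longleftrightarrow> (\<forall>X Y. vectorspace.fin_dim K (Hom C X Y))"

definition krull_remak_schmidt :: "('k, 'o, 'm, 'z) shift_category_scheme \<Rightarrow> bool" where
  "krull_remak_schmidt C \<longleftrightarrow> (\<forall>X.
     (\<exists>Ys. (\<forall>Y \<in> set Ys. indecomposable C Y) \<and> direct_sum C Ys X) \<and>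
     (\<forall>Ys Zs. (\<forall>Y \<in> set Ys. indecomposable C Y) \<and> direct_sum C Ys X \<and>
              (\<forall>Z \<in> set Zs. indecomposable C Z) \<and> direct_sum C Zs X \<longrightarrow>
        (\<exists>Zs'. mset Zs' = mset Zs \<and> list_all2 (isomorphic C) Ys Zs')))"


section \<open>Triangulated categories\<close>

text \<open>
  The shift is only required to be a \<open>K\<close>-linear auto-equivalence (fully faithful and essentially
  surjective), not a strict automorphism.
\<close>

locale triangulated_category = linear_category +
  assumes zero_exists: "\<exists>Z. zero_object C Z"
    and direct_sum_exists: "\<exists>S. direct_sum C [X, Y] S"
    and shift_linear: "shift_mor C \<in> module_hom K (Hom C X Y) (Hom C (shift C X) (shift C Y))"
    and shift_ident: "shift_mor C (ident C X) = ident C (shift C X)"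
    and shift_compose: "\<lbrakk>f \<in> mor C X Y; g \<in> mor C Y Z\<rbrakk>
      \<Longrightarrow> shift_mor C (g \<star> f) = shift_mor C g \<star> shift_mor C f"
    and shift_fully_faithful:
      "bij_betw (shift_mor C) (mor C X Y) (mor C (shift C X) (shift C Y))"
    and shift_ess_surj: "\<exists>X. isomorphic C (shift C X) Y"
    and triangle_mor: "(X, Y, Z, f, g, h) \<in> triangles C
      \<Longrightarrow> f \<in> mor C X Y \<and> g \<in> mor C Y Z \<and> h \<in> mor C Z (shift C X)"
    and TR1_iso: "\<lbrakk>(X, Y, Z, f, g, h) \<in> triangles C;
        f' \<in> mor C X' Y'; g' \<in> mor C Y' Z'; h' \<in> mor C Z' (shift C X');
        iso_mor C X X' a; iso_mor C Y Y' b; iso_mor C Z Z' c;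
        b \<star> f = f' \<star> a; c \<star> g = g' \<star> b; shift_mor C a \<star> h = h' \<star> c\<rbrakk>
      \<Longrightarrow> (X', Y', Z', f', g', h') \<in> triangles C"
    and TR1_ident: "zero_object C Z \<Longrightarrow>
      (X, X, Z, ident C X, \<zero>\<^bsub>Hom C X Z\<^esub>, \<zero>\<^bsub>Hom C Z (shift C X)\<^esub>) \<in> triangles C"
    and TR1_cone: "f \<in> mor C X Y \<Longrightarrow> \<exists>Z g h. (X, Y, Z, f, g, h) \<in> triangles C"
    and TR2: "\<lbrakk>f \<in> mor C X Y; g \<in> mor C Y Z; h \<in> mor C Z (shift C X)\<rbrakk>
      \<Longrightarrow> (X, Y, Z, f, g, h) \<in> triangles C \<longleftrightarrow>
          (Y, Z, shift C X, g, h, \<ominus>\<^bsub>Hom C (shift C X) (shift C Y)\<^esub> shift_mor C f) \<in> triangles C"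
    and TR3: "\<lbrakk>(X, Y, Z, f, g, h) \<in> triangles C; (X', Y', Z', f', g', h') \<in> triangles C;
        a \<in> mor C X X'; b \<in> mor C Y Y'; b \<star> f = f' \<star> a\<rbrakk>
      \<Longrightarrow> \<exists>c \<in> mor C Z Z'. c \<star> g = g' \<star> b \<and> shift_mor C a \<star> h = h' \<star> c"
    and TR4: "\<lbrakk>(X, Y, Z', f, i, i') \<in> triangles C; (Y, Z, X', g, j, j') \<in> triangles C;
        (X, Z, Y', g \<star> f, k, k') \<in> triangles C\<rbrakk>
      \<Longrightarrow> \<exists>u \<in> mor C Z' Y'. \<exists>v \<in> mor C Y' X'.
            (Z', Y', X', u, v, shift_mor C i \<star> j') \<in> triangles C \<and>
            u \<star> i = k \<star> g \<and> k' \<star> u = i' \<and> v \<star> k = j \<and> j' \<star> v = shift_mor C f \<star> k'"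

abbreviation Ext1 :: "('k, 'o, 'm, 'z) shift_category_scheme \<Rightarrow> 'o \<Rightarrow> 'o \<Rightarrow> ('k, 'm) module" where
  "Ext1 C X Y \<equiv> Hom C X (shift C Y)"

text \<open>The dual of a vector space; its elements are extensional functions, and the fields \<open>mult\<close>
  and \<open>one\<close> are dummies required by the type of module records.\<close>

definition regular_module :: "('k, 'r) ring_scheme \<Rightarrow> ('k, 'k) module" where
  "regular_module K = \<lparr>carrier = carrier K, mult = (\<otimes>\<^bsub>K\<^esub>), one = \<one>\<^bsub>K\<^esub>, zero = \<zero>\<^bsub>K\<^esub>,
     add = (\<oplus>\<^bsub>K\<^esub>), smult = (\<otimes>\<^bsub>K\<^esub>)\<rparr>"

definition dual_space ::
    "('k, 'r) ring_scheme \<Rightarrow> ('k, 'v, 's) module_scheme \<Rightarrow> ('k, 'v \<Rightarrow> 'k) module" where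
  "dual_space K V =
     \<lparr>carrier = extensional (carrier V) \<inter> module_hom K V (regular_module K),
      mult = (\<lambda>\<phi> \<psi>. \<lambda>v \<in> carrier V. \<zero>\<^bsub>K\<^esub>),
      one = (\<lambda>v \<in> carrier V. \<zero>\<^bsub>K\<^esub>),
      zero = (\<lambda>v \<in> carrier V. \<zero>\<^bsub>K\<^esub>),
      add = (\<lambda>\<phi> \<psi>. \<lambda>v \<in> carrier V. \<phi> v \<oplus>\<^bsub>K\<^esub> \<psi> v),
      smult = (\<lambda>c \<phi>. \<lambda>v \<in> carrier V. c \<otimes>\<^bsub>K\<^esub> \<phi> v)\<rparr>"

text \<open>
  Naturality of \<open>\<Phi> X Y : Ext\<^sup>1(X, Y) \<rightarrow> D Ext\<^sup>1(Y, X)\<close>: morphisms \<open>a : X' \<rightarrow> X\<close> and \<open>b : Y \<rightarrow> Y'\<close> act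
  by \<open>e \<mapsto> b[1] e a\<close> on \<open>Ext\<^sup>1(X, Y)\<close>, and on \<open>D Ext\<^sup>1(Y, X)\<close> by precomposition with
  \<open>e' \<mapsto> a[1] e' b\<close>, which maps \<open>Ext\<^sup>1(Y', X')\<close> to \<open>Ext\<^sup>1(Y, X)\<close>.
\<close>

definition two_calabi_yau ::
    "('k, 'r) ring_scheme \<Rightarrow> ('k, 'o, 'm, 'z) shift_category_scheme \<Rightarrow> bool" where
  "two_calabi_yau K C \<longleftrightarrow> (\<exists>\<Phi> :: 'o \<Rightarrow> 'o \<Rightarrow> 'm \<Rightarrow> 'm \<Rightarrow> 'k.
     (\<forall>X Y. \<Phi> X Y \<in> module_hom K (Ext1 C X Y) (dual_space K (Ext1 C Y X)) \<and>
            bij_betw (\<Phi> X Y) (carrier (Ext1 C X Y)) (carrier (dual_space K (Ext1 C Y X)))) \<and>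
     (\<forall>X X' Y Y'. \<forall>a \<in> mor C X' X. \<forall>b \<in> mor C Y Y'.
        \<forall>e \<in> carrier (Ext1 C X Y). \<forall>e' \<in> carrier (Ext1 C Y' X').
          \<Phi> X' Y' (shift_mor C b \<star>\<^bsub>C\<^esub> e \<star>\<^bsub>C\<^esub> a) e' = \<Phi> X Y e (shift_mor C a \<star>\<^bsub>C\<^esub> e' \<star>\<^bsub>C\<^esub> b)))"


section \<open>Subcategories\<close>

text \<open>A full subcategory is given by its set of objects.\<close>

definition additive_subcategory :: "('k, 'o, 'm, 'z) shift_category_scheme \<Rightarrow> 'o set \<Rightarrow> bool" where
  "additive_subcategory C T \<longleftrightarrow>
     (\<forall>X \<in> T. \<forall>Y. isomorphic C X Y \<longrightarrow> Y \<in> T) \<and>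
     (\<forall>X \<in> T. \<forall>A. direct_summand C A X \<longrightarrow> A \<in> T) \<and>
     (\<forall>Ys X. set Ys \<subseteq> T \<and> direct_sum C Ys X \<longrightarrow> X \<in> T)"

definition add_closure :: "('k, 'o, 'm, 'z) shift_category_scheme \<Rightarrow> 'o \<Rightarrow> 'o set" where
  "add_closure C M = {A. \<exists>n S. direct_sum C (replicate n M) S \<and> direct_summand C A S}"

definition right_approximation ::
    "('k, 'o, 'm, 'z) shift_category_scheme \<Rightarrow> 'o set \<Rightarrow> 'o \<Rightarrow> 'o \<Rightarrow> 'm \<Rightarrow> bool" where
  "right_approximation C T A X f \<longleftrightarrow> A \<in> T \<and> f \<in> mor C A X \<and>
     (\<forall>B \<in> T. \<forall>g \<in> mor C B X. \<exists>h \<in> mor C B A. g = f \<star>\<^bsub>C\<^esub> h)"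

definition left_approximation ::
    "('k, 'o, 'm, 'z) shift_category_scheme \<Rightarrow> 'o set \<Rightarrow> 'o \<Rightarrow> 'o \<Rightarrow> 'm \<Rightarrow> bool" where
  "left_approximation C T X A f \<longleftrightarrow> A \<in> T \<and> f \<in> mor C X A \<and>
     (\<forall>B \<in> T. \<forall>g \<in> mor C X B. \<exists>h \<in> mor C A B. g = h \<star>\<^bsub>C\<^esub> f)"

definition contravariantly_finite :: "('k, 'o, 'm, 'z) shift_category_scheme \<Rightarrow> 'o set \<Rightarrow> bool" where
  "contravariantly_finite C T \<longleftrightarrow> (\<forall>X. \<exists>A f. right_approximation C T A X f)"

definition covariantly_finite :: "('k, 'o, 'm, 'z) shift_category_scheme \<Rightarrow> 'o set \<Rightarrow> bool" where
  "covariantly_finite C T \<longleftrightarrow> (\<forall>X. \<exists>A f. left_approximation C T X A f)"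

definition functorially_finite :: "('k, 'o, 'm, 'z) shift_category_scheme \<Rightarrow> 'o set \<Rightarrow> bool" where
  "functorially_finite C T \<longleftrightarrow> contravariantly_finite C T \<and> covariantly_finite C T"

definition rigid :: "('k, 'o, 'm, 'z) shift_category_scheme \<Rightarrow> 'o set \<Rightarrow> bool" where
  "rigid C T \<longleftrightarrow> (\<forall>X \<in> T. \<forall>Y \<in> T. carrier (Ext1 C X Y) = {\<zero>\<^bsub>Ext1 C X Y\<^esub>})"

definition maximal_rigid :: "('k, 'o, 'm, 'z) shift_category_scheme \<Rightarrow> 'o set \<Rightarrow> bool" where
  "maximal_rigid C T \<longleftrightarrow> rigid C T \<and> (\<forall>M. rigid C (T \<union> add_closure C M) \<longrightarrow> M \<in> T)"

definition cluster_tilting :: "('k, 'o, 'm, 'z) shift_category_scheme \<Rightarrow> 'o set \<Rightarrow> bool" where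
  "cluster_tilting C T \<longleftrightarrow> functorially_finite C T \<and>
     T = {X. \<forall>Y \<in> T. mor C X (shift C Y) = {\<zero>\<^bsub>Hom C X (shift C Y)\<^esub>}}"

end

theory Submission
  imports Defs
begin

text \<open>
  Throughout, \<open>R\<close> is functorially finite and maximal rigid and \<open>T\<close> is cluster-tilting. What has to be
  shown is that an object \<open>X\<close> with \<open>Ext\<^sup>1(X, R) = 0\<close> lies in \<open>R\<close>. By the \<open>2\<close>-Calabi-Yau
  duality also \<open>Ext\<^sup>1(R, X) = 0\<close>, so by maximality the only question is whether \<open>Ext\<^sup>1(X, X) = 0\<close>.

  The first ingredient is that every rigid object \<open>W\<close> has an \<open>R\<close>-copresentation, a triangle
  \<open>W \<rightarrow> R\<^sub>0 \<rightarrow> R\<^sub>1 \<rightarrow> W[1]\<close> with both terms in \<open>R\<close> (\<open>rigid_copresentation\<close>): the cone of a left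
  \<open>R\<close>-approximation of \<open>W\<close> is again rigid and \<open>Ext\<^sup>1\<close>-orthogonal to \<open>R\<close>. The second one is that every
  \<open>X\<close> has a \<open>T\<close>-presentation, a triangle \<open>T\<^sub>0 \<rightarrow> X \<rightarrow> W[1] \<rightarrow> T\<^sub>0[1]\<close> with \<open>T\<^sub>0\<close> and \<open>W\<close> in \<open>T\<close>
  (\<open>cluster_tilting_presentation\<close>).

  Since \<open>W\<close> is rigid, the two can be combined. The composite \<open>X \<rightarrow> W[1] \<rightarrow> R\<^sub>0[1]\<close> vanishes, so
  \<open>f : X \<rightarrow> W[1]\<close> factors through an object \<open>R\<^sub>1\<close> of \<open>R\<close>. Let \<open>e : X \<rightarrow> X[1]\<close>. Then \<open>f[1] e\<close>
  factors through \<open>Hom(X, R\<^sub>1[1]) = 0\<close>, so \<open>e\<close> factors through \<open>T\<^sub>0[1]\<close>; hence the composite of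
  \<open>T\<^sub>0 \<rightarrow> X\<close> with \<open>e\<close> factors through \<open>Hom(T\<^sub>0, T\<^sub>0[1]) = 0\<close>, so \<open>e\<close> factors through \<open>f\<close>, and
  therefore through \<open>Hom(R\<^sub>1, X[1]) = 0\<close>. This gives \<open>e = 0\<close> (\<open>orthogonal_imp_self_orthogonal\<close>).
\<close>

section \<open>Zero morphisms and vanishing of \<open>Ext\<^sup>1\<close>\<close>

abbreviation ext_orthogonal :: "('k, 'o, 'm, 'z) shift_category_scheme \<Rightarrow> 'o \<Rightarrow> 'o \<Rightarrow> bool" where
  "ext_orthogonal C X Y \<equiv> carrier (Ext1 C X Y) = {\<zero>\<^bsub>Ext1 C X Y\<^esub>}"

context linear_category
begin

lemma Hom_module: "module K (Hom C X Y)"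
  using Hom_vectorspace by (simp add: vectorspace_def)

lemma Hom_abelian_group: "abelian_group (Hom C X Y)"
  using Hom_module by (simp add: module_def)

lemma zero_mor: "\<zero>\<^bsub>Hom C X Y\<^esub> \<in> mor C X Y"
  using Hom_abelian_group abelian_group.axioms(1) abelian_monoid.zero_closed by metis

lemma uminus_mor: "f \<in> mor C X Y \<Longrightarrow> \<ominus>\<^bsub>Hom C X Y\<^esub> f \<in> mor C X Y"
  by (rule abelian_group.a_inv_closed[OF Hom_abelian_group])

lemma module_hom_zero:
  assumes M: "module K M" and N: "module K N" and h: "h \<in> module_hom K M N"
  shows "h \<zero>\<^bsub>M\<^esub> = \<zero>\<^bsub>N\<^esub>"
proof -
  interpret M: abelian_group M using M by (simp add: module_def)
  interpret N: abelian_group N using N by (simp add: module_def)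
  have "h \<zero>\<^bsub>M\<^esub> \<in> carrier N"
    using h by (auto simp: module_hom_def)
  moreover have "h \<zero>\<^bsub>M\<^esub> \<oplus>\<^bsub>N\<^esub> h \<zero>\<^bsub>M\<^esub> = h \<zero>\<^bsub>M\<^esub>"
    using h M.zero_closed unfolding module_hom_def by (force dest: sym)
  ultimately show ?thesis
    using N.add.l_cancel_one by blast
qed

lemma module_hom_uminus:
  assumes M: "module K M" and N: "module K N" and h: "h \<in> module_hom K M N"
    and x: "x \<in> carrier M"
  shows "h (\<ominus>\<^bsub>M\<^esub> x) = \<ominus>\<^bsub>N\<^esub> h x"
proof -
  interpret M: abelian_group M using M by (simp add: module_def)
  interpret N: abelian_group N using N by (simp add: module_def)
  have "h (\<ominus>\<^bsub>M\<^esub> x) \<oplus>\<^bsub>N\<^esub> h x = h (\<ominus>\<^bsub>M\<^esub> x \<oplus>\<^bsub>M\<^esub> x)"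
    using h x M.a_inv_closed unfolding module_hom_def by force
  also have "\<dots> = \<zero>\<^bsub>N\<^esub>"
    using module_hom_zero[OF M N h] x M.l_neg by simp
  finally show ?thesis
    using h x M.a_inv_closed N.minus_equality unfolding module_hom_def by force
qed

lemma compose_zero_right: "g \<in> mor C Y Z \<Longrightarrow> g \<star> \<zero>\<^bsub>Hom C X Y\<^esub> = \<zero>\<^bsub>Hom C X Z\<^esub>"
  using module_hom_zero[OF Hom_module Hom_module compose_linear_right] .

lemma compose_zero_left: "f \<in> mor C X Y \<Longrightarrow> \<zero>\<^bsub>Hom C Y Z\<^esub> \<star> f = \<zero>\<^bsub>Hom C X Z\<^esub>"
  using module_hom_zero[OF Hom_module Hom_module compose_linear_left] .

lemma compose_uminus_right:
  "\<lbrakk>f \<in> mor C X Y; g \<in> mor C Y Z\<rbrakk> \<Longrightarrow> g \<star> (\<ominus>\<^bsub>Hom C X Y\<^esub> f) = \<ominus>\<^bsub>Hom C X Z\<^esub> (g \<star> f)"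
  using module_hom_uminus[OF Hom_module Hom_module compose_linear_right] .

lemma compose_uminus_left:
  "\<lbrakk>f \<in> mor C X Y; g \<in> mor C Y Z\<rbrakk> \<Longrightarrow> (\<ominus>\<^bsub>Hom C Y Z\<^esub> g) \<star> f = \<ominus>\<^bsub>Hom C X Z\<^esub> (g \<star> f)"
  using module_hom_uminus[OF Hom_module Hom_module compose_linear_left] .

lemma uminus_zero: "\<ominus>\<^bsub>Hom C X Y\<^esub> \<zero>\<^bsub>Hom C X Y\<^esub> = \<zero>\<^bsub>Hom C X Y\<^esub>"
  using abelian_group.minus_equality[OF Hom_abelian_group] zero_mor
    abelian_monoid.r_zero[OF abelian_group.axioms(1)[OF Hom_abelian_group]] by metis

lemma uminus_uminus: "f \<in> mor C X Y \<Longrightarrow> \<ominus>\<^bsub>Hom C X Y\<^esub> (\<ominus>\<^bsub>Hom C X Y\<^esub> f) = f"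
  by (rule abelian_group.minus_minus[OF Hom_abelian_group])

lemma zero_objectI:
  assumes "ident C Z = \<zero>\<^bsub>Hom C Z Z\<^esub>"
  shows "zero_object C Z"
proof -
  have "f = \<zero>\<^bsub>Hom C Z X\<^esub>" if "f \<in> mor C Z X" for X f
    using assms compose_zero_right ident_right that by metis
  moreover have "f = \<zero>\<^bsub>Hom C X Z\<^esub>" if "f \<in> mor C X Z" for X f
    using assms compose_zero_left ident_left that by metis
  ultimately show ?thesis
    unfolding zero_object_def using zero_mor by blast
qed

lemma ext_orthogonalI:
  "(\<And>e. e \<in> mor C X (shift C Y) \<Longrightarrow> e = \<zero>\<^bsub>Ext1 C X Y\<^esub>) \<Longrightarrow> ext_orthogonal C X Y"
  using zero_mor by blast

lemma compose_finsum_zero: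
  assumes e: "e \<in> mor C X Y" and "finite I"
    and "\<And>i. i \<in> I \<Longrightarrow> \<phi> i \<in> mor C X X" "\<And>i. i \<in> I \<Longrightarrow> e \<star> \<phi> i = \<zero>\<^bsub>Hom C X Y\<^esub>"
  shows "e \<star> (\<Oplus>\<^bsub>Hom C X X\<^esub> i \<in> I. \<phi> i) = \<zero>\<^bsub>Hom C X Y\<^esub>"
  using assms(2-4)
proof (induction I rule: finite_induct)
  case empty
  interpret H: abelian_group "Hom C X X" by (rule Hom_abelian_group)
  show ?case using compose_zero_right[OF e] by simp
next
  case (insert i I)
  interpret H: abelian_group "Hom C X X" by (rule Hom_abelian_group)
  interpret N: abelian_group "Hom C X Y" by (rule Hom_abelian_group)
  have cl: "\<phi> \<in> I \<rightarrow> mor C X X" "\<phi> i \<in> mor C X X"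
    using insert.prems by auto
  have "e \<star> (\<phi> i \<oplus>\<^bsub>Hom C X X\<^esub> finsum (Hom C X X) \<phi> I) =
      e \<star> \<phi> i \<oplus>\<^bsub>Hom C X Y\<^esub> e \<star> finsum (Hom C X X) \<phi> I"
    using compose_linear_right[OF e] cl H.finsum_closed[OF cl(1)] unfolding module_hom_def by blast
  then show ?case
    using insert cl by simp
qed

lemma ext_orthogonal_direct_sum:
  assumes "direct_sum C Ys X" and Ys: "\<And>Y. Y \<in> set Ys \<Longrightarrow> ext_orthogonal C Y Z"
  shows "ext_orthogonal C X Z"
proof (rule ext_orthogonalI)
  fix e assume e: "e \<in> mor C X (shift C Z)"
  obtain \<iota> \<pi> where \<iota>\<pi>: "\<And>i. i < length Ys \<Longrightarrow> \<iota> i \<in> mor C (Ys ! i) X"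
      "\<And>i. i < length Ys \<Longrightarrow> \<pi> i \<in> mor C X (Ys ! i)"
    and sum: "(\<Oplus>\<^bsub>Hom C X X\<^esub> i \<in> {..<length Ys}. \<iota> i \<star> \<pi> i) = ident C X"
    using assms(1) unfolding direct_sum_def by blast
  have "e \<star> (\<iota> i \<star> \<pi> i) = \<zero>\<^bsub>Ext1 C X Z\<^esub>" if i: "i < length Ys" for i
  proof -
    have "e \<star> \<iota> i = \<zero>\<^bsub>Ext1 C (Ys ! i) Z\<^esub>"
      using Ys[OF nth_mem[OF i]] compose_mor[OF \<iota>\<pi>(1)[OF i] e] by blast
    then show ?thesis
      using compose_assoc[OF \<iota>\<pi>(2)[OF i] \<iota>\<pi>(1)[OF i] e] compose_zero_left[OF \<iota>\<pi>(2)[OF i]] by simp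
  qed
  then have "e \<star> ident C X = \<zero>\<^bsub>Ext1 C X Z\<^esub>"
    unfolding sum[symmetric] by (intro compose_finsum_zero[OF e]) (auto intro: compose_mor \<iota>\<pi>)
  then show "e = \<zero>\<^bsub>Ext1 C X Z\<^esub>"
    using ident_right[OF e] by simp
qed

lemma ext_orthogonal_direct_summand:
  assumes "direct_summand C A X" and X: "ext_orthogonal C X Z"
  shows "ext_orthogonal C A Z"
proof (rule ext_orthogonalI)
  fix e assume e: "e \<in> mor C A (shift C Z)"
  obtain \<iota> \<pi> where \<iota>: "\<iota> \<in> mor C A X" and \<pi>: "\<pi> \<in> mor C X A" and ret: "\<pi> \<star> \<iota> = ident C A"
    using assms(1) unfolding direct_summand_def direct_sum_def by force
  have "e = e \<star> \<pi> \<star> \<iota>"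
    using compose_assoc[OF \<iota> \<pi> e] ret ident_right[OF e] by simp
  also have "e \<star> \<pi> = \<zero>\<^bsub>Ext1 C X Z\<^esub>"
    using X compose_mor[OF \<pi> e] by blast
  finally show "e = \<zero>\<^bsub>Ext1 C A Z\<^esub>"
    using compose_zero_left[OF \<iota>] by simp
qed

lemma ext_orthogonal_add_closure:
  assumes "A \<in> add_closure C M" and "ext_orthogonal C M Z"
  shows "ext_orthogonal C A Z"
proof -
  obtain n S where "direct_sum C (replicate n M) S" "direct_summand C A S"
    using assms(1) unfolding add_closure_def by blast
  then show ?thesis
    using ext_orthogonal_direct_sum[of "replicate n M" S Z] ext_orthogonal_direct_summand assms(2)
    by auto
qed

text \<open>
  The dual of the zero space is zero, so the duality makes vanishing of \<open>Ext\<^sup>1\<close> symmetric. Statements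
  about one argument of \<open>Ext\<^sup>1\<close> therefore transfer to the other.
\<close>

lemma ext_orthogonal_sym:
  assumes cy: "two_calabi_yau K C" and XY: "ext_orthogonal C X Y"
  shows "ext_orthogonal C Y X"
proof -
  obtain \<Phi> :: "'o \<Rightarrow> 'o \<Rightarrow> 'm \<Rightarrow> 'm \<Rightarrow> 'k" where
    \<Phi>: "bij_betw (\<Phi> Y X) (carrier (Ext1 C Y X)) (carrier (dual_space K (Ext1 C X Y)))"
    using cy unfolding two_calabi_yau_def by blast
  have field: "field K" using Hom_vectorspace[of X X] by (simp add: vectorspace_def)
  interpret K: field K by (rule field)
  have ab: "abelian_group (Ext1 C X Y)" by (rule Hom_abelian_group)
  have "\<phi> \<zero>\<^bsub>Ext1 C X Y\<^esub> = \<zero>\<^bsub>K\<^esub>" if "\<phi> \<in> module_hom K (Ext1 C X Y) (regular_module K)" for \<phi>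
  proof -
    have "\<phi> \<zero>\<^bsub>Ext1 C X Y\<^esub> \<in> carrier K"
      using that XY by (auto simp: module_hom_def regular_module_def)
    moreover have "\<phi> \<zero>\<^bsub>Ext1 C X Y\<^esub> \<oplus>\<^bsub>K\<^esub> \<phi> \<zero>\<^bsub>Ext1 C X Y\<^esub> = \<phi> \<zero>\<^bsub>Ext1 C X Y\<^esub>"
      using that abelian_monoid.r_zero[OF abelian_group.axioms(1)[OF ab] zero_mor] zero_mor
      unfolding module_hom_def regular_module_def by force
    ultimately show ?thesis
      using K.add.l_cancel_one by blast
  qed
  then have zero: "\<phi> = (\<lambda>_ \<in> {\<zero>\<^bsub>Ext1 C X Y\<^esub>}. \<zero>\<^bsub>K\<^esub>)"
    if "\<phi> \<in> carrier (dual_space K (Ext1 C X Y))" for \<phi>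
    using that XY
    by (intro extensionalityI[of _ "{\<zero>\<^bsub>Ext1 C X Y\<^esub>}"]) (simp_all add: dual_space_def)
  show ?thesis
  proof (rule ext_orthogonalI)
    fix e assume e: "e \<in> mor C Y (shift C X)"
    have "\<Phi> Y X e = \<Phi> Y X \<zero>\<^bsub>Ext1 C Y X\<^esub>"
      using zero[OF bij_betw_apply[OF \<Phi> e]] zero[OF bij_betw_apply[OF \<Phi> zero_mor]] by simp
    then show "e = \<zero>\<^bsub>Ext1 C Y X\<^esub>"
      by (rule inj_onD[OF bij_betw_imp_inj_on[OF \<Phi>] _ e zero_mor])
  qed
qed

text \<open>
  Maximality is phrased with \<open>add M\<close>; since \<open>Ext\<^sup>1\<close>-orthogonality passes to sums and summands, it
  can be tested on \<open>M\<close> alone, and by symmetry on one side only.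
\<close>

lemma maximal_rigid_memI:
  assumes cy: "two_calabi_yau K C" and R: "maximal_rigid C R"
    and MR: "\<And>Y. Y \<in> R \<Longrightarrow> ext_orthogonal C M Y" and MM: "ext_orthogonal C M M"
  shows "M \<in> R"
proof -
  have addR: "ext_orthogonal C A Y" if "A \<in> add_closure C M" "Y \<in> R" for A Y
    by (rule ext_orthogonal_add_closure[OF that(1) MR[OF that(2)]])
  have addM: "ext_orthogonal C A M" if "A \<in> add_closure C M" for A
    by (rule ext_orthogonal_add_closure[OF that MM])
  have addadd: "ext_orthogonal C A B" if "A \<in> add_closure C M" "B \<in> add_closure C M" for A B
    by (rule ext_orthogonal_add_closure[OF that(1) ext_orthogonal_sym[OF cy addM[OF that(2)]]])
  have "rigid C (R \<union> add_closure C M)"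
    unfolding rigid_def
  proof (intro ballI)
    fix A B assume "A \<in> R \<union> add_closure C M" "B \<in> R \<union> add_closure C M"
    then consider "A \<in> R" "B \<in> R" | "A \<in> add_closure C M" "B \<in> R"
      | "A \<in> R" "B \<in> add_closure C M" | "A \<in> add_closure C M" "B \<in> add_closure C M"
      by blast
    then show "ext_orthogonal C A B"
    proof cases
      case 1
      then show ?thesis using R unfolding maximal_rigid_def rigid_def by simp
    next
      case AB: 2
      show ?thesis by (rule addR[OF AB])
    next
      case AB: 3
      show ?thesis by (rule ext_orthogonal_sym[OF cy addR[OF AB(2,1)]])
    next
      case AB: 4
      show ?thesis by (rule addadd[OF AB])
    qed
  qed
  then show ?thesis
    using R unfolding maximal_rigid_def by simp
qed

end


section \<open>Weak kernels and weak cokernels in triangles\<close>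

context triangulated_category
begin

lemma shift_mor: "f \<in> mor C X Y \<Longrightarrow> shift_mor C f \<in> mor C (shift C X) (shift C Y)"
  using shift_fully_faithful by (rule bij_betw_apply)

lemma shift_mor_zero: "shift_mor C \<zero>\<^bsub>Hom C X Y\<^esub> = \<zero>\<^bsub>Hom C (shift C X) (shift C Y)\<^esub>"
  by (rule module_hom_zero[OF Hom_module Hom_module shift_linear])

lemma shift_mor_eqD:
  "\<lbrakk>shift_mor C f = shift_mor C g; f \<in> mor C X Y; g \<in> mor C X Y\<rbrakk> \<Longrightarrow> f = g"
  using shift_fully_faithful[of X Y] unfolding bij_betw_def inj_on_def by blast

lemma shift_mor_full:
  assumes "g \<in> mor C (shift C X) (shift C Y)"
  obtains f where "f \<in> mor C X Y" "g = shift_mor C f"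
  using assms shift_fully_faithful[of X Y] by (auto simp: bij_betw_def)

lemma zero_object_shift:
  assumes "zero_object C Z"
  shows "zero_object C (shift C Z)"
proof -
  have "ident C Z = \<zero>\<^bsub>Hom C Z Z\<^esub>"
    using assms ident_mor unfolding zero_object_def by blast
  then show ?thesis
    using zero_objectI shift_ident shift_mor_zero by metis
qed

lemma triangle_rotate:
  assumes t: "(X, Y, Z, f, g, h) \<in> triangles C"
  shows "(Y, Z, shift C X, g, h, \<ominus>\<^bsub>Hom C (shift C X) (shift C Y)\<^esub> shift_mor C f) \<in> triangles C"
  using t triangle_mor[OF t] TR2 by blast

lemma triangle_compose_zero:
  assumes t: "(X, Y, Z, f, g, h) \<in> triangles C"
  shows "g \<star> f = \<zero>\<^bsub>Hom C X Z\<^esub>"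
proof -
  obtain N where N: "zero_object C N" using zero_exists by blast
  have fg: "f \<in> mor C X Y" "g \<in> mor C Y Z" using triangle_mor[OF t] by auto
  obtain c where "c \<in> mor C N Z" "c \<star> \<zero>\<^bsub>Hom C X N\<^esub> = g \<star> f"
    using TR3[OF TR1_ident[OF N] t ident_mor fg(1)] by blast
  then show ?thesis using compose_zero_right by metis
qed

lemma triangle_shift_compose_zero:
  assumes t: "(X, Y, Z, f, g, h) \<in> triangles C" and u: "u \<in> mor C Y W"
  shows "shift_mor C (u \<star> f) \<star> h = \<zero>\<^bsub>Hom C Z (shift C W)\<^esub>"
proof -
  have fh: "f \<in> mor C X Y" "h \<in> mor C Z (shift C X)" using triangle_mor[OF t] by auto
  have "\<ominus>\<^bsub>Hom C Z (shift C Y)\<^esub> (shift_mor C f \<star> h) = \<zero>\<^bsub>Hom C Z (shift C Y)\<^esub>"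
    using triangle_compose_zero[OF triangle_rotate[OF triangle_rotate[OF t]]]
      compose_uminus_left[OF fh(2) shift_mor[OF fh(1)]] by simp
  then have "shift_mor C f \<star> h = \<zero>\<^bsub>Hom C Z (shift C Y)\<^esub>"
    using uminus_uminus[OF compose_mor[OF fh(2) shift_mor[OF fh(1)]]] uminus_zero by simp
  then show ?thesis
    using shift_compose[OF fh(1) u] compose_assoc[OF fh(2) shift_mor[OF fh(1)] shift_mor[OF u]]
      compose_zero_right[OF shift_mor[OF u]] by simp
qed

text \<open>The factorization is a morphism from the given triangle to \<open>0 \<rightarrow> W \<rightarrow> W \<rightarrow> 0\<close>.\<close>

lemma triangle_weak_cokernel:
  assumes t: "(X, Y, Z, f, g, h) \<in> triangles C"
    and a: "a \<in> mor C Y W" "a \<star> f = \<zero>\<^bsub>Hom C X W\<^esub>"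
  obtains c where "c \<in> mor C Z W" "a = c \<star> g"
proof -
  obtain N where N: "zero_object C N" using zero_exists by blast
  have "(W, W, shift C N, ident C W, \<zero>\<^bsub>Hom C W (shift C N)\<^esub>,
      \<ominus>\<^bsub>Hom C (shift C N) (shift C W)\<^esub> shift_mor C \<zero>\<^bsub>Hom C N W\<^esub>) \<in> triangles C"
    unfolding shift_mor_zero uminus_zero by (rule TR1_ident[OF zero_object_shift[OF N]])
  then have s: "(N, W, W, \<zero>\<^bsub>Hom C N W\<^esub>, ident C W, \<zero>\<^bsub>Hom C W (shift C N)\<^esub>) \<in> triangles C"
    using TR2[OF zero_mor ident_mor zero_mor] by blast
  have "a \<star> f = \<zero>\<^bsub>Hom C N W\<^esub> \<star> \<zero>\<^bsub>Hom C X N\<^esub>"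
    using a compose_zero_left[OF zero_mor] by simp
  from TR3[OF t s zero_mor a(1) this] show ?thesis
    using that ident_left[OF a(1)] by metis
qed

text \<open>
  The factorization is a morphism from \<open>W \<rightarrow> 0 \<rightarrow> W[1] \<rightarrow> W[1]\<close> to the rotated triangle; it is
  found between the shifted objects and pulled back along the fully faithful shift.
\<close>

lemma triangle_weak_kernel:
  assumes t: "(X, Y, Z, f, g, h) \<in> triangles C"
    and a: "a \<in> mor C W Y" "g \<star> a = \<zero>\<^bsub>Hom C W Z\<^esub>"
  obtains c where "c \<in> mor C W X" "a = f \<star> c"
proof -
  obtain N where N: "zero_object C N" using zero_exists by blast
  have f: "f \<in> mor C X Y" using triangle_mor[OF t] by blast
  have "\<zero>\<^bsub>Hom C N Z\<^esub> \<star> \<zero>\<^bsub>Hom C W N\<^esub> = g \<star> a"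
    using a compose_zero_left[OF zero_mor] by simp
  from TR3[OF triangle_rotate[OF TR1_ident[OF N]] triangle_rotate[OF t] a(1) zero_mor this]
  obtain c where c: "c \<in> mor C (shift C W) (shift C X)"
    and eq: "shift_mor C a \<star> (\<ominus>\<^bsub>Hom C (shift C W) (shift C W)\<^esub> shift_mor C (ident C W)) =
      (\<ominus>\<^bsub>Hom C (shift C X) (shift C Y)\<^esub> shift_mor C f) \<star> c"
    by blast
  obtain c' where c': "c' \<in> mor C W X" "c = shift_mor C c'"
    using c by (rule shift_mor_full)
  have "\<ominus>\<^bsub>Hom C (shift C W) (shift C Y)\<^esub> shift_mor C a =
      \<ominus>\<^bsub>Hom C (shift C W) (shift C Y)\<^esub> shift_mor C (f \<star> c')"
    using eq shift_ident ident_mor ident_right shift_mor[OF a(1)] shift_mor[OF f] c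
      compose_uminus_right compose_uminus_left c' shift_compose[OF c'(1) f] by metis
  then have "shift_mor C a = shift_mor C (f \<star> c')"
    using uminus_uminus shift_mor a(1) compose_mor[OF c'(1) f] by metis
  then show ?thesis
    using that[OF c'(1)] shift_mor_eqD a(1) compose_mor[OF c'(1) f] by blast
qed

text \<open>Three rotations change the shifted triangle only by signs.\<close>

lemma triangle_weak_kernel_shift:
  assumes t: "(X, Y, Z, f, g, h) \<in> triangles C"
    and a: "a \<in> mor C W (shift C Y)" "shift_mor C g \<star> a = \<zero>\<^bsub>Hom C W (shift C Z)\<^esub>"
  obtains c where "c \<in> mor C W (shift C X)" "a = shift_mor C f \<star> c"
proof -
  have fg: "f \<in> mor C X Y" "g \<in> mor C Y Z" using triangle_mor[OF t] by auto
  let ?f = "\<ominus>\<^bsub>Hom C (shift C X) (shift C Y)\<^esub> shift_mor C f"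
  let ?g = "\<ominus>\<^bsub>Hom C (shift C Y) (shift C Z)\<^esub> shift_mor C g"
  have "?g \<star> a = \<zero>\<^bsub>Hom C W (shift C Z)\<^esub>"
    using compose_uminus_left[OF a(1) shift_mor[OF fg(2)]] a(2) uminus_zero by simp
  from triangle_weak_kernel[OF triangle_rotate[OF triangle_rotate[OF triangle_rotate[OF t]]] a(1) this]
  obtain c where c: "c \<in> mor C W (shift C X)" "a = ?f \<star> c" .
  have "a = shift_mor C f \<star> (\<ominus>\<^bsub>Hom C W (shift C X)\<^esub> c)"
    using c compose_uminus_left[OF c(1) shift_mor[OF fg(1)]]
      compose_uminus_right[OF c(1) shift_mor[OF fg(1)]] by simp
  then show ?thesis using that uminus_mor[OF c(1)] by blast
qed


section \<open>Approximation triangles\<close>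

text \<open>
  A morphism \<open>Y \<rightarrow> B[1]\<close> vanishes on \<open>A\<close> and so factors through \<open>W[1]\<close>; the resulting \<open>W \<rightarrow> B\<close>
  extends along the approximation \<open>f\<close>, and \<open>f[1] h = 0\<close>.
\<close>

lemma cone_left_approximation_orthogonal:
  assumes R: "rigid C R" and f: "left_approximation C R W A f"
    and t: "(W, A, Y, f, g, h) \<in> triangles C" and B: "B \<in> R"
  shows "ext_orthogonal C Y B"
proof (rule ext_orthogonalI)
  fix e assume e: "e \<in> mor C Y (shift C B)"
  have A: "A \<in> R" and fm: "f \<in> mor C W A" using f unfolding left_approximation_def by auto
  have gh: "g \<in> mor C A Y" "h \<in> mor C Y (shift C W)" using triangle_mor[OF t] by auto
  have "e \<star> g = \<zero>\<^bsub>Ext1 C A B\<^esub>"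
    using R A B compose_mor[OF gh(1) e] unfolding rigid_def by blast
  then obtain p where p: "p \<in> mor C (shift C W) (shift C B)" "e = p \<star> h"
    using triangle_weak_cokernel[OF triangle_rotate[OF t] e] by blast
  obtain p' where p': "p' \<in> mor C W B" "p = shift_mor C p'"
    using p(1) by (rule shift_mor_full)
  obtain r where r: "r \<in> mor C A B" "p' = r \<star> f"
    using f B p'(1) unfolding left_approximation_def by blast
  show "e = \<zero>\<^bsub>Ext1 C Y B\<^esub>"
    using triangle_shift_compose_zero[OF t r(1)] p(2) p'(2) r(2) by simp
qed

text \<open>
  The second term of the copresentation is the cone \<open>Y\<close> of a left \<open>R\<close>-approximation \<open>f : W \<rightarrow> A\<close>.
  A morphism \<open>e : Y \<rightarrow> Y[1]\<close> vanishes on \<open>A\<close>, so it is \<open>p[1] h\<close> for some \<open>p : W \<rightarrow> Y\<close>. Rigidity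
  of \<open>W\<close> lifts \<open>p\<close> to \<open>A\<close>, and the lift extends along \<open>f\<close>; hence \<open>e = 0\<close> because \<open>f[1] h = 0\<close>.
\<close>

lemma rigid_copresentation:
  assumes cy: "two_calabi_yau K C" and R: "maximal_rigid C R" "covariantly_finite C R"
    and W: "ext_orthogonal C W W"
  obtains A Y f g h where "A \<in> R" "Y \<in> R" "(W, A, Y, f, g, h) \<in> triangles C"
proof -
  have rig: "rigid C R" using R(1) unfolding maximal_rigid_def by blast
  obtain A f where f: "left_approximation C R W A f"
    using R(2) unfolding covariantly_finite_def by blast
  then have A: "A \<in> R" and fm: "f \<in> mor C W A" unfolding left_approximation_def by auto
  obtain Y g h where t: "(W, A, Y, f, g, h) \<in> triangles C"
    using TR1_cone[OF fm] by blast
  have gh: "g \<in> mor C A Y" "h \<in> mor C Y (shift C W)" using triangle_mor[OF t] by auto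
  have YR: "ext_orthogonal C Y B" if "B \<in> R" for B
    by (rule cone_left_approximation_orthogonal[OF rig f t that])
  have "ext_orthogonal C Y Y"
  proof (rule ext_orthogonalI)
    fix e assume e: "e \<in> mor C Y (shift C Y)"
    have "e \<star> g = \<zero>\<^bsub>Ext1 C A Y\<^esub>"
      using ext_orthogonal_sym[OF cy YR[OF A]] compose_mor[OF gh(1) e] by blast
    then obtain p where p: "p \<in> mor C (shift C W) (shift C Y)" "e = p \<star> h"
      using triangle_weak_cokernel[OF triangle_rotate[OF t] e] by blast
    obtain p' where p': "p' \<in> mor C W Y" "p = shift_mor C p'"
      using p(1) by (rule shift_mor_full)
    have "h \<star> p' = \<zero>\<^bsub>Ext1 C W W\<^esub>"
      using W compose_mor[OF p'(1) gh(2)] by blast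
    then obtain s where s: "s \<in> mor C W A" "p' = g \<star> s"
      using triangle_weak_kernel[OF triangle_rotate[OF t] p'(1)] by blast
    obtain r where r: "r \<in> mor C A A" "s = r \<star> f"
      using f A s(1) unfolding left_approximation_def by blast
    have "p' = (g \<star> r) \<star> f"
      using s(2) r(2) compose_assoc[OF fm r(1) gh(1)] by simp
    then show "e = \<zero>\<^bsub>Ext1 C Y Y\<^esub>"
      using triangle_shift_compose_zero[OF t compose_mor[OF r(1) gh(1)]] p(2) p'(2) by simp
  qed
  then have "Y \<in> R" using maximal_rigid_memI[OF cy R(1) YR] by blast
  then show ?thesis using that A t by blast
qed

text \<open>
  The cone of a right \<open>T\<close>-approximation \<open>A \<rightarrow> X\<close> has the form \<open>W[1]\<close>, since the shift is essentially
  surjective. The composite of a morphism from an object of \<open>T\<close> to \<open>W[1]\<close> with \<open>h : W[1] \<rightarrow> A[1]\<close>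
  vanishes, so the morphism lifts to \<open>X\<close> and further to \<open>A\<close>, and is therefore zero. By symmetry \<open>W\<close>
  lies in \<open>T\<close>.
\<close>

lemma cluster_tilting_presentation:
  assumes cy: "two_calabi_yau K C" and T: "cluster_tilting C T"
  obtains A W f g h where "A \<in> T" "W \<in> T" "(A, X, shift C W, f, g, h) \<in> triangles C"
proof -
  have Teq: "Y \<in> T \<longleftrightarrow> (\<forall>B \<in> T. ext_orthogonal C Y B)" for Y
    using T unfolding cluster_tilting_def by blast
  obtain A f where f: "right_approximation C T A X f"
    using T unfolding cluster_tilting_def functorially_finite_def contravariantly_finite_def by blast
  then have A: "A \<in> T" and fm: "f \<in> mor C A X" unfolding right_approximation_def by auto
  obtain Z g h where t: "(A, X, Z, f, g, h) \<in> triangles C"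
    using TR1_cone[OF fm] by blast
  have gh: "g \<in> mor C X Z" "h \<in> mor C Z (shift C A)" using triangle_mor[OF t] by auto
  obtain W b where b: "iso_mor C (shift C W) Z b"
    using shift_ess_surj unfolding isomorphic_def by blast
  then obtain c where bm: "b \<in> mor C (shift C W) Z" and cm: "c \<in> mor C Z (shift C W)"
    and cb: "c \<star> b = ident C (shift C W)" and bc: "b \<star> c = ident C Z"
    unfolding iso_mor_def by blast
  have c: "iso_mor C Z (shift C W) c"
    using bm cm cb bc unfolding iso_mor_def by blast
  have id: "iso_mor C V V (ident C V)" for V
    using ident_mor ident_left unfolding iso_mor_def by blast
  let ?g = "c \<star> g" and ?h = "h \<star> b"
  have g: "?g \<in> mor C X (shift C W)" and h: "?h \<in> mor C (shift C W) (shift C A)"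
    using compose_mor gh bm cm by auto
  have s: "(A, X, shift C W, f, ?g, ?h) \<in> triangles C"
  proof (rule TR1_iso[OF t fm g h id id c])
    show "ident C X \<star> f = f \<star> ident C A"
      using ident_left ident_right fm by simp
    show "c \<star> g = ?g \<star> ident C X"
      using ident_right g by simp
    have "?h \<star> c = h"
      using compose_assoc[OF cm bm gh(2)] bc ident_right gh(2) by simp
    then show "shift_mor C (ident C A) \<star> h = ?h \<star> c"
      using shift_ident ident_left gh(2) by simp
  qed
  have "ext_orthogonal C B W" if B: "B \<in> T" for B
  proof (rule ext_orthogonalI)
    fix e assume e: "e \<in> mor C B (shift C W)"
    have "?h \<star> e = \<zero>\<^bsub>Ext1 C B A\<^esub>"
      using Teq A B compose_mor[OF e h] by blast
    then obtain l where l: "l \<in> mor C B X" "e = ?g \<star> l"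
      using triangle_weak_kernel[OF triangle_rotate[OF s] e] by blast
    obtain m where m: "m \<in> mor C B A" "l = f \<star> m"
      using f B l(1) unfolding right_approximation_def by blast
    have "e = (?g \<star> f) \<star> m"
      using l m compose_assoc[OF m(1) fm g] by simp
    then show "e = \<zero>\<^bsub>Ext1 C B W\<^esub>"
      using triangle_compose_zero[OF s] compose_zero_left[OF m(1)] by simp
  qed
  then have "W \<in> T"
    using Teq ext_orthogonal_sym[OF cy] by blast
  then show ?thesis using that A s by blast
qed


section \<open>Orthogonal objects are rigid\<close>

text \<open>
  The morphism \<open>f : X \<rightarrow> W[1]\<close> of a \<open>T\<close>-presentation of \<open>X\<close> factors through \<open>R\<^sub>1\<close>. This is used
  once after \<open>e : X \<rightarrow> X[1]\<close>, where \<open>Ext\<^sup>1(X, R\<^sub>1) = 0\<close> kills \<open>f[1] e\<close>, and once before the remaining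
  factor of \<open>e\<close>, where \<open>Ext\<^sup>1(R\<^sub>1, X) = 0\<close> does. Rigidity of \<open>T\<^sub>0\<close>, here called \<open>A\<close>, links the two.
\<close>

lemma orthogonal_imp_self_orthogonal:
  assumes cy: "two_calabi_yau K C" and T: "cluster_tilting C T"
    and R: "maximal_rigid C R" "covariantly_finite C R"
    and XR: "\<And>B. B \<in> R \<Longrightarrow> ext_orthogonal C X B"
  shows "ext_orthogonal C X X"
proof (rule ext_orthogonalI)
  fix e assume e: "e \<in> mor C X (shift C X)"
  obtain A W u f w where A: "A \<in> T" and W: "W \<in> T"
    and t: "(A, X, shift C W, u, f, w) \<in> triangles C"
    using cluster_tilting_presentation[OF cy T] .
  have AA: "ext_orthogonal C A A" and WW: "ext_orthogonal C W W"
    using T A W unfolding cluster_tilting_def by blast+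
  obtain R\<^sub>0 R\<^sub>1 p q b where R01: "R\<^sub>0 \<in> R" "R\<^sub>1 \<in> R"
    and s: "(W, R\<^sub>0, R\<^sub>1, p, q, b) \<in> triangles C"
    using rigid_copresentation[OF cy R WW] .
  have uf: "u \<in> mor C A X" "f \<in> mor C X (shift C W)" using triangle_mor[OF t] by auto
  have pb: "p \<in> mor C W R\<^sub>0" "b \<in> mor C R\<^sub>1 (shift C W)" using triangle_mor[OF s] by auto
  let ?p = "\<ominus>\<^bsub>Hom C (shift C W) (shift C R\<^sub>0)\<^esub> shift_mor C p"
  have "?p \<star> f = \<zero>\<^bsub>Ext1 C X R\<^sub>0\<^esub>"
    using XR[OF R01(1)] compose_mor[OF uf(2) uminus_mor[OF shift_mor[OF pb(1)]]] by blast
  then obtain a where a: "a \<in> mor C X R\<^sub>1" "f = b \<star> a"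
    using triangle_weak_kernel[OF triangle_rotate[OF triangle_rotate[OF s]] uf(2)] by blast
  have "shift_mor C a \<star> e = \<zero>\<^bsub>Ext1 C X R\<^sub>1\<^esub>"
    using XR[OF R01(2)] compose_mor[OF e shift_mor[OF a(1)]] by blast
  then have "shift_mor C f \<star> e = \<zero>\<^bsub>Hom C X (shift C (shift C W))\<^esub>"
    using a(2) shift_compose[OF a(1) pb(2)] compose_assoc[OF e shift_mor[OF a(1)] shift_mor[OF pb(2)]]
      compose_zero_right[OF shift_mor[OF pb(2)]] by simp
  then obtain d where d: "d \<in> mor C X (shift C A)" "e = shift_mor C u \<star> d"
    using triangle_weak_kernel_shift[OF t e] by blast
  have "d \<star> u = \<zero>\<^bsub>Ext1 C A A\<^esub>"
    using AA compose_mor[OF uf(1) d(1)] by blast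
  then have "e \<star> u = \<zero>\<^bsub>Ext1 C A X\<^esub>"
    using d(2) compose_assoc[OF uf(1) d(1) shift_mor[OF uf(1)]]
      compose_zero_right[OF shift_mor[OF uf(1)]] by simp
  then obtain k where k: "k \<in> mor C (shift C W) (shift C X)" "e = k \<star> f"
    using triangle_weak_cokernel[OF t e] by blast
  have "k \<star> b = \<zero>\<^bsub>Ext1 C R\<^sub>1 X\<^esub>"
    using ext_orthogonal_sym[OF cy XR[OF R01(2)]] compose_mor[OF pb(2) k(1)] by blast
  then show "e = \<zero>\<^bsub>Ext1 C X X\<^esub>"
    using k(2) a(2) compose_assoc[OF a(1) pb(2) k(1)] compose_zero_left[OF a(1)] by simp
qed

end

theorem theorem2p6:
  fixes K :: "('k, 'r) ring_scheme"
    and C :: "('k, 'o, 'm, 'z) shift_category_scheme"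
  assumes "algebraically_closed K"
    and "triangulated_category K C"
    and "hom_finite K C"
    and "krull_remak_schmidt C"
    and "two_calabi_yau K C"
    and "\<exists>T. additive_subcategory C T \<and> cluster_tilting C T"
  shows "\<forall>R. additive_subcategory C R \<and> functorially_finite C R \<and> maximal_rigid C R
           \<longrightarrow> cluster_tilting C R"
proof (intro allI impI)
  fix R assume R: "additive_subcategory C R \<and> functorially_finite C R \<and> maximal_rigid C R"
  interpret triangulated_category K C by fact
  have cov: "covariantly_finite C R"
    using R unfolding functorially_finite_def by blast
  obtain T where T: "cluster_tilting C T" using assms(6) by blast
  have "X \<in> R" if "\<And>Y. Y \<in> R \<Longrightarrow> ext_orthogonal C X Y" for X
    using maximal_rigid_memI[OF assms(5)] orthogonal_imp_self_orthogonal[OF assms(5) T _ cov]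
      R that by blast
  moreover have "ext_orthogonal C X Y" if "X \<in> R" "Y \<in> R" for X Y
    using R that unfolding maximal_rigid_def rigid_def by blast
  ultimately show "cluster_tilting C R"
    using R unfolding cluster_tilting_def by blast
qed

end
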